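(* Let $d \ge 1$, let $0 \le \bar h \in L^1(\mathbf{R}^d \times \mathbf{R}^d)$ and let $0 \le f, g \in L^1(\mathbf{R}^d)$ have the same total mass $\int f = \int g$. Let $\Gamma = \Gamma(f,g)^{\bar h}$ denote the set of joint densities bounded by $\bar h$ and with marginals $f$ and $g$. A density $h \in \Gamma$ is an extreme point of $\Gamma$ if and only if $h = 1_W \bar h$ (almost everywhere) for some Lebesgue measurable set $W \subset \mathbf{R}^d \times \mathbf{R}^d$.
   Context: For $0 \le f, g \in L^1(\mathbf{R}^d)$ with $\int f = \int g$ and $0 \le \bar h \in L^1(\mathbf{R}^d \times \mathbf{R}^d)$, the set $\Gamma(f,g)^{\bar h}$ consists of all $0 \le h \in L^1(\mathbf{R}^d \times \mathbf{R}^d)$ (functions identified when equal Lebesgue-a.e.) such that $\int_{\mathbf{R}^d} h(x,\tilde y)\,d\tilde y = f(x)$ for Lebesgue-a.e. $x$, $\int_{\mathbf{R}^d} h(\tilde x,y)\,d\tilde x = g(y)$ for Lebesgue-a.e. $y$, and $h \le \bar h$ almost everywhere. An element $h \in \Gamma$ is an extreme point of the convex set $\Gamma$ if it is not the midpoint of any nondegenerate segment in $\Gamma$, i.e. $h = \frac12(h_+ + h_-)$ with $h_\pm \in \Gamma$ implies $h_+ = h_-$. $1_W$ denotes the indicator function of $W$. *)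

theory Defs
  imports "HOL-Analysis.Analysis"
begin

text \<open>Elements of \<open>L\<^sup>1\<close> are represented by functions; equality and order are taken
  Lebesgue-almost everywhere.\<close>

definition ae_eq :: "('a::euclidean_space \<Rightarrow> real) \<Rightarrow> ('a \<Rightarrow> real) \<Rightarrow> bool" where
  "ae_eq u v \<longleftrightarrow> (AE z in lebesgue. u z = v z)"

definition nonneg_L1 :: "('a::euclidean_space \<Rightarrow> real) \<Rightarrow> bool" where
  "nonneg_L1 u \<longleftrightarrow> integrable lebesgue u \<and> (AE z in lebesgue. 0 \<le> u z)"

text \<open>Since \<open>h\<close> is integrable, by Fubini almost every section of \<open>h\<close> is integrable,
  so the value \<open>0\<close> that the Bochner integral assigns to non-integrable
  sections is irrelevant in the marginal conditions.\<close>

definition bounded_densities ::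
  "(real^'n \<Rightarrow> real) \<Rightarrow> (real^'n \<Rightarrow> real) \<Rightarrow> ((real^'n) \<times> (real^'n) \<Rightarrow> real)
    \<Rightarrow> ((real^'n) \<times> (real^'n) \<Rightarrow> real) set" where
  "bounded_densities f g hbar =
    {h. nonneg_L1 h
      \<and> (AE x in lebesgue. (LINT y|lebesgue. h (x, y)) = f x)
      \<and> (AE y in lebesgue. (LINT x|lebesgue. h (x, y)) = g y)
      \<and> (AE z in lebesgue. h z \<le> hbar z)}"

text \<open>Extreme points of a set of functions taken modulo a.e. equality; the library's
  \<open>extreme_point_of\<close> would require the quotient as a real vector space.\<close>

definition ae_extreme_point ::
  "('a::euclidean_space \<Rightarrow> real) \<Rightarrow> ('a \<Rightarrow> real) set \<Rightarrow> bool" where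
  "ae_extreme_point h S \<longleftrightarrow>
    h \<in> S \<and> (\<forall>hp\<in>S. \<forall>hm\<in>S. ae_eq h (\<lambda>z. (hp z + hm z) / 2) \<longrightarrow> ae_eq hp hm)"

end

theory Submission
  imports Defs
begin

text \<open>
  If \<open>h = 1\<^sub>W hbar\<close>, then \<open>h\<close> only takes the two extreme values \<open>0\<close> and \<open>hbar\<close> allowed by the
  pointwise constraint \<open>0 \<le> h \<le> hbar\<close>, so a midpoint decomposition is trivial almost everywhere
  (\<open>bang_bang_extreme\<close>).

  Conversely, if \<open>h\<close> is not of this form, then for some \<open>\<delta> > 0\<close> the set
  \<open>A = {\<delta> \<le> h \<le> hbar - \<delta>}\<close> has positive measure, and \<open>h\<close> can be perturbed there in both
  directions as long as the perturbation has vanishing marginals. Such perturbations come from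
  axis-parallel parallelograms: given a set \<open>B\<close> of positive measure and shifts \<open>s\<close>, \<open>t\<close> for which
  \<open>B\<close>, \<open>B + (s, 0)\<close>, \<open>B + (0, t)\<close> and \<open>B + (s, t)\<close> all lie in \<open>A\<close>, the signed sum
  \<open>1\<^sub>B - 1\<^bsub>B + (s, 0)\<^esub> - 1\<^bsub>B + (0, t)\<^esub> + 1\<^bsub>B + (s, t)\<^esub>\<close> integrates to zero over every
  horizontal and vertical section, because Lebesgue measure is translation invariant
  (\<open>mixed_difference_marginals\<close>). The shifts exist by a recurrence argument: a bounded set of
  positive measure cannot have arbitrarily many translates inside a fixed ball that are pairwise
  disjoint up to null sets (\<open>nonnegligible_recurrence\<close>). Applying this once in each of the two
  factors yields the parallelograms (\<open>nonnegligible_contains_parallelograms\<close>), and shrinking \<open>B\<close>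
  to a ball that is small compared with \<open>s\<close> and \<open>t\<close> prevents the signed sum from cancelling
  on \<open>B\<close>.
\<close>

section \<open>Translates of sets of positive measure\<close>

lemma nonnegligible_inter_small_ball:
  fixes A :: "'a::euclidean_space set"
  assumes "\<not> negligible A" "r > 0"
  obtains q where "\<not> negligible (A \<inter> ball q r)"
proof -
  obtain D :: "'a set" where D: "countable D" "\<And>X. open X \<Longrightarrow> X \<noteq> {} \<Longrightarrow> \<exists>d\<in>D. d \<in> X"
    by (rule countable_dense_setE) blast
  have "A \<subseteq> \<Union>((\<lambda>q. A \<inter> ball q r) ` D)"
  proof
    fix z assume "z \<in> A"
    moreover obtain q where "q \<in> D" "q \<in> ball z r"
      using D(2)[of "ball z r"] \<open>r > 0\<close> by auto
    ultimately show "z \<in> \<Union>((\<lambda>q. A \<inter> ball q r) ` D)"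
      by (auto simp: dist_commute)
  qed
  then have "\<not> (\<forall>q\<in>D. negligible (A \<inter> ball q r))"
    using assms(1) D(1) negligible_countable_Union[of "(\<lambda>q. A \<inter> ball q r) ` D"]
      negligible_subset by blast
  then show thesis using that by blast
qed

lemma borel_inter_translate:
  fixes A :: "'a::euclidean_space set"
  assumes "A \<in> sets borel"
  shows "{z\<in>A. z + v \<in> A} \<in> sets borel"
proof -
  have "(\<lambda>z. z + v) -` A \<inter> space borel \<in> sets borel"
    by (rule measurable_sets[OF _ assms]) measurable
  moreover have "{z\<in>A. z + v \<in> A} = A \<inter> ((\<lambda>z. z + v) -` A \<inter> space borel)"
    by auto
  ultimately show ?thesis using assms by simp
qed

text \<open>This is Poincare recurrence for translations. The translates of \<open>A\<close> by \<open>(k / n) v\<close>,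
  \<open>k < n\<close>, have total measure \<open>n |A|\<close> but all lie in one ball whose radius does not depend
  on \<open>n\<close>; for large \<open>n\<close> two of them must overlap, and their relative shift is the required \<open>c v\<close>.\<close>

lemma nonnegligible_recurrence:
  fixes A :: "'a::euclidean_space set"
  assumes "A \<in> sets borel" "bounded A" "\<not> negligible A"
  obtains c :: real where "c \<noteq> 0" "\<not> negligible {z\<in>A. z + c *\<^sub>R v \<in> A}"
proof (rule ccontr)
  assume "\<not> thesis"
  with that have null: "negligible {z\<in>A. z + c *\<^sub>R v \<in> A}" if "c \<noteq> 0" for c
    using \<open>c \<noteq> 0\<close> by blast
  have A: "A \<in> lmeasurable"
    using assms by (intro bounded_set_imp_lmeasurable) auto
  have pos: "measure lebesgue A > 0"
    using A assms(3) negligible_iff_measure by (metis zero_less_measure_iff)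
  obtain R where R: "\<And>z. z \<in> A \<Longrightarrow> norm z \<le> R"
    using assms(2) bounded_iff by blast
  define K where "K = cball (0::'a) (R + norm v)"
  obtain n :: nat where n: "real n * measure lebesgue A > measure lebesgue K"
    using reals_Archimedean3[OF pos] by blast
  define T where "T k = (+) ((real k / real n) *\<^sub>R v) ` A" for k :: nat
  have T: "T k \<in> lmeasurable" "measure lebesgue (T k) = measure lebesgue A" for k
    unfolding T_def using A by (auto intro: measurable_translation measure_translation)
  have sub: "\<Union>(T ` {..<n}) \<subseteq> K"
  proof -
    have "(real k / real n) *\<^sub>R v + z \<in> K" if "k < n" "z \<in> A" for k z
    proof -
      have "norm ((real k / real n) *\<^sub>R v + z) \<le> norm ((real k / real n) *\<^sub>R v) + norm z"
        by (rule norm_triangle_ineq)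
      also have "norm ((real k / real n) *\<^sub>R v) \<le> 1 * norm v"
        unfolding norm_scaleR using \<open>k < n\<close> by (intro mult_right_mono) auto
      finally show ?thesis
        using R[OF \<open>z \<in> A\<close>] by (simp add: K_def)
    qed
    then show ?thesis by (auto simp: T_def simp del: scaleR_scaleR)
  qed
  have "pairwise (\<lambda>j k. negligible (T j \<inter> T k)) {..<n}"
  proof (rule pairwiseI)
    fix j k assume jk: "j \<in> {..<n}" "k \<in> {..<n}" "j \<noteq> k"
    define c where "c = real j / real n - real k / real n"
    have "c \<noteq> 0" using jk by (auto simp: c_def)
    have "T j \<inter> T k \<subseteq> (+) ((real j / real n) *\<^sub>R v) ` {z\<in>A. z + c *\<^sub>R v \<in> A}"
    proof
      fix w assume "w \<in> T j \<inter> T k"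
      then obtain z z' where w: "z \<in> A" "z' \<in> A" "w = (real j / real n) *\<^sub>R v + z"
        "w = (real k / real n) *\<^sub>R v + z'"
        unfolding T_def by blast
      then have "z + c *\<^sub>R v = z'"
        unfolding c_def scaleR_left_diff_distrib by (simp add: algebra_simps)
      with w show "w \<in> (+) ((real j / real n) *\<^sub>R v) ` {z\<in>A. z + c *\<^sub>R v \<in> A}"
        by blast
    qed
    then show "negligible (T j \<inter> T k)"
      using null[OF \<open>c \<noteq> 0\<close>] negligible_subset negligible_translation by blast
  qed
  then have "measure lebesgue (\<Union>(T ` {..<n})) = (\<Sum>k<n. measure lebesgue (T k))"
    using T by (intro measure_negligible_finite_Union_image) auto
  also have "\<dots> = real n * measure lebesgue A"
    using T by simp
  finally have "real n * measure lebesgue A = measure lebesgue (\<Union>(T ` {..<n}))" ..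
  also have "\<dots> \<le> measure lebesgue K"
  proof (rule measure_mono_fmeasurable[OF sub])
    show "\<Union>(T ` {..<n}) \<in> sets lebesgue"
      using T(1) by (intro sets.finite_UN) (auto dest: fmeasurableD)
  qed (simp add: K_def)
  finally have "real n * measure lebesgue A \<le> measure lebesgue K" .
  with n show False by simp
qed

text \<open>Recurrence in a direction of the first factor gives a set \<open>A1\<close> of points \<open>z\<close> with \<open>z\<close> and
  \<open>z + (s, 0)\<close> in \<open>A\<close>; recurrence of \<open>A1\<close> in a direction of the second factor gives the
  other two corners. The last conclusion keeps the positive corner \<open>B\<close> away from the two negative
  ones, so that the signed sum of the four indicators is at least \<open>1\<close> on \<open>B\<close>.\<close>

lemma nonnegligible_contains_parallelograms:
  fixes A :: "('a::euclidean_space \<times> 'b::euclidean_space) set"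
  assumes "A \<in> sets borel" "\<not> negligible A"
  obtains B s t where "B \<in> sets borel" "bounded B" "\<not> negligible B"
    "\<And>x y. (x, y) \<in> B \<Longrightarrow> (x, y) \<in> A \<and> (x + s, y) \<in> A \<and> (x, y + t) \<in> A \<and> (x + s, y + t) \<in> A"
    "\<And>x y. (x, y) \<in> B \<Longrightarrow> (x - s, y) \<notin> B \<and> (x, y - t) \<notin> B"
proof -
  \<comment> \<open>Recurrence needs a bounded set.\<close>
  obtain q where q: "\<not> negligible (A \<inter> ball q 1)"
    using nonnegligible_inter_small_ball[OF assms(2)] zero_less_one by blast
  define A0 where "A0 = A \<inter> ball q 1"
  have A0: "A0 \<in> sets borel" "bounded A0" "\<not> negligible A0"
    using assms q by (auto simp: A0_def intro: bounded_Int)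
  obtain a :: 'a where a: "a \<in> Basis" using nonempty_Basis by blast
  obtain b :: 'b where b: "b \<in> Basis" using nonempty_Basis by blast
  obtain c where c: "c \<noteq> 0" "\<not> negligible {z\<in>A0. z + c *\<^sub>R (a, 0) \<in> A0}"
    using nonnegligible_recurrence[OF A0] by blast
  define A1 where "A1 = {z\<in>A0. z + c *\<^sub>R (a, 0) \<in> A0}"
  have A1: "A1 \<in> sets borel" "bounded A1" "\<not> negligible A1"
    using A0 c by (auto simp: A1_def intro!: borel_inter_translate intro: bounded_subset)
  obtain c' where c': "c' \<noteq> 0" "\<not> negligible {z\<in>A1. z + c' *\<^sub>R (0, b) \<in> A1}"
    using nonnegligible_recurrence[OF A1] by blast
  define A2 where "A2 = {z\<in>A1. z + c' *\<^sub>R (0, b) \<in> A1}"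
  have A2: "A2 \<in> sets borel" "\<not> negligible A2"
    using A1 c' by (auto simp: A2_def intro!: borel_inter_translate)
  define s t where "s = c *\<^sub>R a" and "t = c' *\<^sub>R b"
  have st: "s \<noteq> 0" "t \<noteq> 0"
    using c c' a b by (auto simp: s_def t_def)
  \<comment> \<open>A ball of this radius has diameter too small to contain two points that differ by
    \<open>(s, 0)\<close> or \<open>(0, t)\<close>.\<close>
  define r where "r = min (norm s) (norm t) / 2"
  have "r > 0" using st by (simp add: r_def)
  then obtain p where p: "\<not> negligible (A2 \<inter> ball p r)"
    using nonnegligible_inter_small_ball[OF A2(2)] by blast
  show thesis
  proof (rule that[of "A2 \<inter> ball p r" s t])
    show "A2 \<inter> ball p r \<in> sets borel" using A2 by auto
    show "bounded (A2 \<inter> ball p r)" by (auto intro: bounded_Int)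
    show "\<not> negligible (A2 \<inter> ball p r)" by (rule p)
    fix x y assume xy: "(x, y) \<in> A2 \<inter> ball p r"
    then show "(x, y) \<in> A \<and> (x + s, y) \<in> A \<and> (x, y + t) \<in> A \<and> (x + s, y + t) \<in> A"
      by (auto simp: A2_def A1_def A0_def s_def t_def add_ac)
    have far: "w \<notin> ball p r" if "dist (x, y) w \<ge> 2 * r" for w
      using xy that dist_triangle3[of "(x,y)" w p] by auto
    have "dist (x, y) (x - s, y) = norm s" "dist (x, y) (x, y - t) = norm t"
      by (simp_all add: dist_prod_def dist_norm)
    then show "(x - s, y) \<notin> A2 \<inter> ball p r \<and> (x, y - t) \<notin> A2 \<inter> ball p r"
      using far[of "(x - s, y)"] far[of "(x, y - t)"] by (auto simp: r_def)
  qed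
qed

section \<open>Perturbations with vanishing marginals\<close>

text \<open>This is \<open>1\<^sub>B - 1\<^bsub>B + (s, 0)\<^esub> - 1\<^bsub>B + (0, t)\<^esub> + 1\<^bsub>B + (s, t)\<^esub>\<close>; each translate of \<open>B\<close> is
  expressed by shifting the argument of \<open>1\<^sub>B\<close> instead, so that sections are visible.\<close>

definition mixed_difference ::
  "'a::euclidean_space \<Rightarrow> 'b::euclidean_space \<Rightarrow> ('a \<times> 'b) set \<Rightarrow> 'a \<times> 'b \<Rightarrow> real" where
  "mixed_difference s t B = (\<lambda>(x, y). indicator B (x, y) - indicator B (x - s, y)
     - indicator B (x, y - t) + indicator B (x - s, y - t))"

lemma integral_diff_translate_eq_0:
  fixes k :: "'a::euclidean_space \<Rightarrow> real"
  assumes "integrable lborel k"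
  shows "integrable lborel (\<lambda>y. k y - k (y - t))" "(LINT y|lborel. k y - k (y - t)) = 0"
proof -
  have k: "k \<in> borel_measurable borel" using assms by auto
  have "integrable (distr lborel borel ((+) (- t))) k"
    by (simp add: lborel_distr_plus assms)
  then have i: "integrable lborel (\<lambda>y. k (y - t))"
    by (subst (asm) integrable_distr_eq) (auto simp: k)
  have "(LINT y|lborel. k (y - t)) = integral\<^sup>L (distr lborel borel ((+) (- t))) k"
    by (subst integral_distr) (auto simp: k)
  then have "(LINT y|lborel. k (y - t)) = (LINT y|lborel. k y)"
    by (simp add: lborel_distr_plus)
  then show "integrable lborel (\<lambda>y. k y - k (y - t))" "(LINT y|lborel. k y - k (y - t)) = 0"
    using i assms by auto
qed

lemma integrable_indicator_bounded_borel:
  assumes "B \<in> sets borel" "bounded (B :: 'a::euclidean_space set)"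
  shows "integrable lborel (indicator B :: 'a \<Rightarrow> real)"
  using assms emeasure_bounded_finite by (auto intro!: integrable_real_indicator)

lemma integrable_indicator_sections:
  fixes B :: "('a::euclidean_space \<times> 'b::euclidean_space) set"
  assumes "B \<in> sets borel" "bounded B"
  shows "integrable lborel (\<lambda>y. indicator B (x, y) :: real)"
    and "integrable lborel (\<lambda>x. indicator B (x, y) :: real)"
proof -
  have "(\<lambda>y. indicator B (x, y) :: real) = indicator (snd ` (B \<inter> {x} \<times> UNIV))"
    and "snd ` (B \<inter> {x} \<times> UNIV) = Pair x -` B \<inter> space borel"
    by (force simp: indicator_def fun_eq_iff)+
  moreover have "Pair x -` B \<inter> space borel \<in> sets borel"
    by (rule measurable_sets[OF _ assms(1)]) (auto intro: borel_measurable_Pair)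
  moreover have "bounded (snd ` (B \<inter> {x} \<times> UNIV))"
    using assms(2) by (intro bounded_snd bounded_Int) auto
  ultimately show "integrable lborel (\<lambda>y. indicator B (x, y) :: real)"
    using integrable_indicator_bounded_borel by metis
  have "(\<lambda>x. indicator B (x, y) :: real) = indicator (fst ` (B \<inter> UNIV \<times> {y}))"
    and "fst ` (B \<inter> UNIV \<times> {y}) = (\<lambda>x. (x, y)) -` B \<inter> space borel"
    by (force simp: indicator_def fun_eq_iff)+
  moreover have "(\<lambda>x. (x, y)) -` B \<inter> space borel \<in> sets borel"
    by (rule measurable_sets[OF _ assms(1)]) (auto intro: borel_measurable_Pair)
  moreover have "bounded (fst ` (B \<inter> UNIV \<times> {y}))"
    using assms(2) by (intro bounded_fst bounded_Int) auto
  ultimately show "integrable lborel (\<lambda>x. indicator B (x, y) :: real)"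
    using integrable_indicator_bounded_borel by metis
qed

text \<open>Every section of the mixed difference has the form \<open>k - k(\<cdot> - t)\<close>, respectively
  \<open>k - k(\<cdot> - s)\<close>, with \<open>k\<close> a difference of two integrable sections of the indicator.\<close>

lemma mixed_difference_marginals:
  fixes B :: "('a::euclidean_space \<times> 'b::euclidean_space) set"
  assumes "B \<in> sets borel" "bounded B"
  shows "has_bochner_integral lborel (\<lambda>y. mixed_difference s t B (x, y)) 0"
    and "has_bochner_integral lborel (\<lambda>x. mixed_difference s t B (x, y)) 0"
proof -
  note sections = integrable_indicator_sections[OF assms]
  have "integrable lborel (\<lambda>y. indicator B (x, y) - indicator B (x - s, y) :: real)"
    by (intro Bochner_Integration.integrable_diff sections)
  from integral_diff_translate_eq_0[OF this, of t]
  show "has_bochner_integral lborel (\<lambda>y. mixed_difference s t B (x, y)) 0"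
    unfolding has_bochner_integral_iff mixed_difference_def by (simp add: algebra_simps)
  have "integrable lborel (\<lambda>x. indicator B (x, y) - indicator B (x, y - t) :: real)"
    by (intro Bochner_Integration.integrable_diff sections)
  from integral_diff_translate_eq_0[OF this, of s]
  show "has_bochner_integral lborel (\<lambda>x. mixed_difference s t B (x, y)) 0"
    unfolding has_bochner_integral_iff mixed_difference_def by (simp add: algebra_simps)
qed

lemma mixed_difference_integrable:
  fixes B :: "('a::euclidean_space \<times> 'b::euclidean_space) set"
  assumes "B \<in> sets borel" "bounded B"
  shows "integrable lborel (mixed_difference s t B)"
proof -
  let ?k = "\<lambda>z. indicator B z - indicator B (z - (s, 0)) :: real"
  have "integrable lborel ?k"
    by (intro integral_diff_translate_eq_0 integrable_indicator_bounded_borel assms)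
  then have "integrable lborel (\<lambda>z. ?k z - ?k (z - (0, t)))"
    by (rule integral_diff_translate_eq_0)
  moreover have "(\<lambda>z. ?k z - ?k (z - (0, t))) = mixed_difference s t B"
    by (auto simp: fun_eq_iff mixed_difference_def algebra_simps)
  ultimately show ?thesis by simp
qed

lemma has_bochner_integral_lebesgue:
  fixes k :: "'a::euclidean_space \<Rightarrow> real"
  assumes "has_bochner_integral lborel k i"
  shows "has_bochner_integral lebesgue k i"
proof -
  have "k \<in> borel_measurable lborel"
    using assms by (auto simp: has_bochner_integral_iff)
  with assms show ?thesis
    by (simp add: has_bochner_integral_iff integrable_completion integral_completion)
qed

text \<open>If \<open>u\<close> is not integrable, then neither is the perturbed function, and both integrals take
  the same default value \<open>0\<close>. This lets the marginal conditions be transferred on every section.\<close>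

lemma integral_add_of_integral_0:
  fixes u k :: "'a \<Rightarrow> real"
  assumes "has_bochner_integral M k 0"
  shows "(LINT x|M. u x + c * k x) = (LINT x|M. u x)"
proof -
  have k: "integrable M (\<lambda>x. c * k x)" "(LINT x|M. c * k x) = 0"
    using assms by (auto simp: has_bochner_integral_iff)
  show ?thesis
  proof (cases "integrable M u")
    case True
    then show ?thesis using k by simp
  next
    case False
    have "\<not> integrable M (\<lambda>x. u x + c * k x)"
    proof
      assume "integrable M (\<lambda>x. u x + c * k x)"
      from Bochner_Integration.integrable_diff[OF this k(1)] False show False by simp
    qed
    with False show ?thesis by (simp add: not_integrable_integral_eq)
  qed
qed

section \<open>Extreme points\<close>

text \<open>On \<open>W\<close> the midpoint of \<open>hp\<close> and \<open>hm\<close> equals their common upper bound \<open>hbar\<close>, off \<open>W\<close> it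
  equals their common lower bound \<open>0\<close>; in either case both must attain the bound.\<close>

lemma bang_bang_extreme:
  assumes h: "h \<in> bounded_densities f g hbar"
    and W: "ae_eq h (\<lambda>z. indicator W z * hbar z)"
  shows "ae_extreme_point h (bounded_densities f g hbar)"
  unfolding ae_extreme_point_def
proof (intro conjI ballI impI)
  fix hp hm assume pm: "hp \<in> bounded_densities f g hbar" "hm \<in> bounded_densities f g hbar"
    and mid: "ae_eq h (\<lambda>z. (hp z + hm z) / 2)"
  have "AE z in lebesgue. 0 \<le> hp z" "AE z in lebesgue. 0 \<le> hm z"
    "AE z in lebesgue. hp z \<le> hbar z" "AE z in lebesgue. hm z \<le> hbar z"
    using pm by (auto simp: bounded_densities_def nonneg_L1_def)
  then show "ae_eq hp hm"
    using W mid unfolding ae_eq_def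
  proof eventually_elim
    case (elim z)
    then show ?case by (cases "z \<in> W") auto
  qed
qed (rule h)

lemma perturbation_in_bounded_densities:
  assumes h: "h \<in> bounded_densities f g hbar"
    and \<phi>: "integrable lebesgue \<phi>"
      "\<And>x. has_bochner_integral lebesgue (\<lambda>y. \<phi> (x, y)) 0"
      "\<And>y. has_bochner_integral lebesgue (\<lambda>x. \<phi> (x, y)) 0"
    and bounds: "AE z in lebesgue. 0 \<le> h z + c * \<phi> z" "AE z in lebesgue. h z + c * \<phi> z \<le> hbar z"
  shows "(\<lambda>z. h z + c * \<phi> z) \<in> bounded_densities f g hbar"
  using h \<phi>(1) bounds
  by (simp add: bounded_densities_def nonneg_L1_def integral_add_of_integral_0[OF \<phi>(2)]
      integral_add_of_integral_0[OF \<phi>(3)])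

text \<open>The core of the hard direction: if the set where \<open>h\<close> keeps distance \<open>\<delta>\<close> from both constraints
  had positive measure, let \<open>\<phi>\<close> be the mixed difference of a set \<open>B\<close> all four of whose translates
  lie in it. Then \<open>h \<plusminus> (\<delta> / 2) \<phi>\<close> would be two admissible densities with midpoint \<open>h\<close> that differ
  on \<open>B\<close>, where \<open>\<phi> \<ge> 1\<close>. The functions \<open>h'\<close> and \<open>hbar'\<close> stand for Borel versions of \<open>h\<close> and
  \<open>hbar\<close>, so that every section of \<open>B\<close> is measurable.\<close>

lemma extreme_imp_gap_negligible:
  fixes hbar h hbar' h' :: "(real^'n) \<times> (real^'n) \<Rightarrow> real"
  assumes ext: "ae_extreme_point h (bounded_densities f g hbar)"
    and ae: "AE z in lebesgue. h z = h' z" "AE z in lebesgue. hbar z = hbar' z"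
    and A: "{z. \<delta> \<le> h' z \<and> h' z + \<delta> \<le> hbar' z} \<in> sets borel"
    and "\<delta> > 0"
  shows "negligible {z. \<delta> \<le> h' z \<and> h' z + \<delta> \<le> hbar' z}" (is "negligible ?A")
proof (rule ccontr)
  assume "\<not> negligible ?A"
  then obtain B s t where B: "B \<in> sets borel" "bounded B" "\<not> negligible B"
    and inA: "\<And>x y. (x, y) \<in> B \<Longrightarrow> (x, y) \<in> ?A \<and> (x + s, y) \<in> ?A \<and> (x, y + t) \<in> ?A \<and> (x + s, y + t) \<in> ?A"
    and disj: "\<And>x y. (x, y) \<in> B \<Longrightarrow> (x - s, y) \<notin> B \<and> (x, y - t) \<notin> B"
    by (rule nonnegligible_contains_parallelograms[OF A]) blast
  define \<phi> where "\<phi> = mixed_difference s t B"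
  have supp: "z \<in> ?A" if "\<phi> z \<noteq> 0" for z
  proof (cases z)
    case (Pair x y)
    with that have "(x, y) \<in> B \<or> (x - s, y) \<in> B \<or> (x, y - t) \<in> B \<or> (x - s, y - t) \<in> B"
      by (auto simp: \<phi>_def mixed_difference_def indicator_def split: if_splits)
    then show ?thesis
      using inA[of x y] inA[of "x - s" y] inA[of x "y - t"] inA[of "x - s" "y - t"]
      by (auto simp: Pair)
  qed
  have bound: "\<bar>\<phi> z\<bar> \<le> 2" for z
    by (cases z) (auto simp: \<phi>_def mixed_difference_def indicator_def)
  have ge1: "\<phi> z \<ge> 1" if "z \<in> B" for z
    using that disj by (cases z) (auto simp: \<phi>_def mixed_difference_def indicator_def)
  have h: "h \<in> bounded_densities f g hbar"
    using ext by (simp add: ae_extreme_point_def)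
  then have h0: "AE z in lebesgue. 0 \<le> h z" "AE z in lebesgue. h z \<le> hbar z"
    by (auto simp: bounded_densities_def nonneg_L1_def)
  have dens: "(\<lambda>z. h z + c * \<phi> z) \<in> bounded_densities f g hbar" if c: "\<bar>c\<bar> = \<delta> / 2" for c
  proof (rule perturbation_in_bounded_densities[OF h])
    show "integrable lebesgue \<phi>"
      using mixed_difference_integrable[OF B(1,2)] unfolding \<phi>_def
      by (simp add: integrable_completion borel_measurable_integrable)
    show "has_bochner_integral lebesgue (\<lambda>y. \<phi> (x, y)) 0" for x
      unfolding \<phi>_def by (intro has_bochner_integral_lebesgue mixed_difference_marginals B)
    show "has_bochner_integral lebesgue (\<lambda>x. \<phi> (x, y)) 0" for y
      unfolding \<phi>_def by (intro has_bochner_integral_lebesgue mixed_difference_marginals B)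
    have small: "\<bar>c * \<phi> z\<bar> \<le> \<delta>" for z
      using mult_left_mono[OF bound[of z], of "\<delta> / 2"] \<open>\<delta> > 0\<close> by (simp add: abs_mult c)
    show "AE z in lebesgue. 0 \<le> h z + c * \<phi> z"
      using h0 ae
    proof eventually_elim
      case (elim z)
      then show ?case using supp[of z] small[of z] by (cases "\<phi> z = 0") auto
    qed
    show "AE z in lebesgue. h z + c * \<phi> z \<le> hbar z"
      using h0 ae
    proof eventually_elim
      case (elim z)
      then show ?case using supp[of z] small[of z] by (cases "\<phi> z = 0") auto
    qed
  qed
  have "ae_eq (\<lambda>z. h z + \<delta> / 2 * \<phi> z) (\<lambda>z. h z + - (\<delta> / 2) * \<phi> z)"
  proof -
    have "ae_eq h (\<lambda>z. ((h z + \<delta> / 2 * \<phi> z) + (h z + - (\<delta> / 2) * \<phi> z)) / 2)"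
      by (simp add: ae_eq_def)
    with ext dens[of "\<delta> / 2"] dens[of "- (\<delta> / 2)"] \<open>\<delta> > 0\<close> show ?thesis
      unfolding ae_extreme_point_def by auto
  qed
  then have "AE z in lebesgue. z \<notin> B"
    unfolding ae_eq_def
  proof eventually_elim
    case (elim z)
    then have "\<phi> z = 0" using \<open>\<delta> > 0\<close> by simp
    then show ?case using ge1[of z] by auto
  qed
  then have "negligible B"
    using B(1) by (simp add: negligible_iff_null_sets AE_iff_null_sets)
  with B(3) show False by simp
qed

text \<open>The set \<open>{0 < h < hbar}\<close> is the countable union over \<open>n\<close> of the sets on which \<open>h\<close> keeps
  distance \<open>1 / (n + 1)\<close> from both constraints, hence null; so \<open>W = {h \<noteq> 0}\<close> works.\<close>

lemma extreme_imp_bang_bang: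
  fixes hbar h :: "(real^'n) \<times> (real^'n) \<Rightarrow> real"
  assumes ext: "ae_extreme_point h (bounded_densities f g hbar)"
    and hbar: "hbar \<in> borel_measurable lebesgue"
  shows "\<exists>W\<in>sets lebesgue. ae_eq h (\<lambda>z. indicator W z * hbar z)"
proof -
  have h: "h \<in> borel_measurable lebesgue" "AE z in lebesgue. 0 \<le> h z" "AE z in lebesgue. h z \<le> hbar z"
    using ext by (auto simp: ae_extreme_point_def bounded_densities_def nonneg_L1_def)
  obtain h' where h': "h' \<in> borel_measurable borel" "AE z in lebesgue. h z = h' z"
    using completion_ex_borel_measurable_real[OF h(1)] by (auto simp: AE_completion_iff)
  obtain hbar' where hbar': "hbar' \<in> borel_measurable borel" "AE z in lebesgue. hbar z = hbar' z"
    using completion_ex_borel_measurable_real[OF hbar] by (auto simp: AE_completion_iff)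
  define A where "A n = {z. inverse (Suc n) \<le> h' z \<and> h' z + inverse (Suc n) \<le> hbar' z}" for n :: nat
  have A: "A n \<in> sets borel" for n
  proof -
    have "{z \<in> space borel. inverse (Suc n) \<le> h' z \<and> h' z + inverse (Suc n) \<le> hbar' z} \<in> sets borel"
      using h'(1) hbar'(1) by measurable
    then show ?thesis by (simp add: A_def)
  qed
  have "negligible (A n)" for n
    using extreme_imp_gap_negligible[OF ext h'(2) hbar'(2), of "inverse (Suc n)"] A[of n]
    unfolding A_def by simp
  then have "AE z in lebesgue. \<forall>n. z \<notin> A n"
    unfolding AE_all_countable by (auto simp: negligible_iff_null_sets intro: AE_not_in)
  then have "ae_eq h (\<lambda>z. indicator {z. h' z \<noteq> 0} z * hbar z)"
    using h(2,3) h'(2) hbar'(2) unfolding ae_eq_def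
  proof eventually_elim
    case (elim z)
    show ?case
    proof (rule ccontr)
      assume "\<not> ?case"
      then have "0 < min (h' z) (hbar' z - h' z)"
        using elim by (cases "h' z = 0") auto
      then obtain n where "inverse (real (Suc n)) < min (h' z) (hbar' z - h' z)"
        using reals_Archimedean by blast
      then have "z \<in> A n" by (auto simp: A_def)
      with elim(1) show False by blast
    qed
  qed
  moreover have "{z. h' z \<noteq> 0} \<in> sets lebesgue"
  proof -
    have "{z \<in> space borel. h' z \<noteq> 0} \<in> sets borel" using h'(1) by measurable
    then show ?thesis by simp
  qed
  ultimately show ?thesis by blast
qed

theorem proposition3p2:
  fixes f g :: "real^'n \<Rightarrow> real"
    and hbar h :: "(real^'n) \<times> (real^'n) \<Rightarrow> real"
  assumes "nonneg_L1 hbar" and "nonneg_L1 f" and "nonneg_L1 g"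
    and "(LINT x|lebesgue. f x) = (LINT y|lebesgue. g y)"
    and "h \<in> bounded_densities f g hbar"
  shows "ae_extreme_point h (bounded_densities f g hbar) \<longleftrightarrow>
    (\<exists>W\<in>sets lebesgue. ae_eq h (\<lambda>z. indicator W z * hbar z))"
proof
  assume "ae_extreme_point h (bounded_densities f g hbar)"
  moreover have "hbar \<in> borel_measurable lebesgue"
    using assms(1) by (auto simp: nonneg_L1_def)
  ultimately show "\<exists>W\<in>sets lebesgue. ae_eq h (\<lambda>z. indicator W z * hbar z)"
    by (rule extreme_imp_bang_bang)
next
  assume "\<exists>W\<in>sets lebesgue. ae_eq h (\<lambda>z. indicator W z * hbar z)"
  then show "ae_extreme_point h (bounded_densities f g hbar)"
    using bang_bang_extreme[OF assms(5)] by blast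
qed

end
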